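(* Every Berger-Moerdijk EZ category is an Eilenberg-Zilber category with the same degree function. Conversely, an Eilenberg-Zilber category $A$ is a Berger-Moerdijk EZ category (with the same degree function) if and only if every morphism of $A_+$ is a monomorphism.
   Context: A \emph{generalized Reedy category} is an essentially small category $A$ equipped with a degree function $\deg:\mathrm{Ob}\,A\to\mathbb{N}$ which respects isomorphisms (isomorphic objects have equal degree) and an orthogonal factorization system $(A_-,A_+)$ (left class $A_-$, right class $A_+$), such that every non-isomorphism of $A_-$ strictly lowers degree and every non-isomorphism of $A_+$ strictly raises degree. An \emph{Eilenberg-Zilber category} is a generalized Reedy category $A$ such that every pair of morphisms of $A_-$ with a common domain has an absolute pushout in $A$. A colimit is \emph{absolute} if it is preserved by every functor (equivalently, by the Yoneda embedding into presheaves of sets). A \emph{Berger-Moerdijk EZ category} is an essentially small category $A$ equipped with a degree function $\deg:\mathrm{Ob}\,A\to\mathbb{N}$ such that (1) a monomorphism preserves (resp. raises) degree if and only if it is invertible (resp. noninvertible); (2) every morphism admits a factorization as a split epimorphism followed by a monomorphism; (3) every pair of split epimorphisms with a common domain has an absolute pushout. *)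

theory Defs
  imports Main "HOL-Library.FuncSet"
begin

section \<open>Categories\<close>

text \<open>
  Every category below has a set of objects and a set of morphisms, so no smallness condition
  appears: an essentially small category is one that is small up to equivalence, and the types
  of objects and morphisms are arbitrary. The object and morphism types may contain junk;
  every condition is relativised to \<open>Obj\<close> and \<open>Mor\<close>.
\<close>

record ('o, 'm) cat =
  Obj :: "'o set"
  Mor :: "'m set"
  Dom :: "'m \<Rightarrow> 'o"
  Cod :: "'m \<Rightarrow> 'o"
  Ident :: "'o \<Rightarrow> 'm"
  Comp :: "'m \<Rightarrow> 'm \<Rightarrow> 'm"  (infixl "\<cdot>\<index>" 70)

definition hom :: "('o, 'm) cat \<Rightarrow> 'o \<Rightarrow> 'o \<Rightarrow> 'm set" where
  "hom C x y = {f \<in> Mor C. Dom C f = x \<and> Cod C f = y}"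

locale category =
  fixes C :: "('o, 'm) cat" (structure)
  assumes Dom_in: "f \<in> Mor C \<Longrightarrow> Dom C f \<in> Obj C"
    and Cod_in: "f \<in> Mor C \<Longrightarrow> Cod C f \<in> Obj C"
    and Ident_in: "x \<in> Obj C \<Longrightarrow> Ident C x \<in> hom C x x"
    and Comp_in: "f \<in> hom C x y \<Longrightarrow> g \<in> hom C y z \<Longrightarrow> g \<cdot> f \<in> hom C x z"
    and Ident_left: "f \<in> hom C x y \<Longrightarrow> Ident C y \<cdot> f = f"
    and Ident_right: "f \<in> hom C x y \<Longrightarrow> f \<cdot> Ident C x = f"
    and Comp_assoc: "f \<in> hom C w x \<Longrightarrow> g \<in> hom C x y \<Longrightarrow> h \<in> hom C y z
      \<Longrightarrow> (h \<cdot> g) \<cdot> f = h \<cdot> (g \<cdot> f)"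

definition isomorphism :: "('o, 'm) cat \<Rightarrow> 'm \<Rightarrow> bool" where
  "isomorphism C f \<longleftrightarrow> f \<in> Mor C \<and>
     (\<exists>g \<in> hom C (Cod C f) (Dom C f).
        Comp C g f = Ident C (Dom C f) \<and> Comp C f g = Ident C (Cod C f))"

definition isomorphic_objects :: "('o, 'm) cat \<Rightarrow> 'o \<Rightarrow> 'o \<Rightarrow> bool" where
  "isomorphic_objects C x y \<longleftrightarrow> (\<exists>f \<in> hom C x y. isomorphism C f)"

definition monomorphism :: "('o, 'm) cat \<Rightarrow> 'm \<Rightarrow> bool" where
  "monomorphism C f \<longleftrightarrow> f \<in> Mor C \<and>
     (\<forall>x \<in> Obj C. \<forall>g \<in> hom C x (Dom C f). \<forall>h \<in> hom C x (Dom C f).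
        Comp C f g = Comp C f h \<longrightarrow> g = h)"

definition split_epimorphism :: "('o, 'm) cat \<Rightarrow> 'm \<Rightarrow> bool" where
  "split_epimorphism C f \<longleftrightarrow> f \<in> Mor C \<and>
     (\<exists>s \<in> hom C (Cod C f) (Dom C f). Comp C f s = Ident C (Cod C f))"


section \<open>Functors and absolute pushouts\<close>

definition is_functor ::
    "('o, 'm) cat \<Rightarrow> ('p, 'n) cat \<Rightarrow> ('o \<Rightarrow> 'p) \<Rightarrow> ('m \<Rightarrow> 'n) \<Rightarrow> bool" where
  "is_functor C D Fo Fm \<longleftrightarrow>
     (\<forall>x \<in> Obj C. Fo x \<in> Obj D) \<and>
     (\<forall>f \<in> Mor C. Fm f \<in> hom D (Fo (Dom C f)) (Fo (Cod C f))) \<and>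
     (\<forall>x \<in> Obj C. Fm (Ident C x) = Ident D (Fo x)) \<and>
     (\<forall>f \<in> Mor C. \<forall>g \<in> Mor C. Dom C g = Cod C f \<longrightarrow>
        Fm (Comp C g f) = Comp D (Fm g) (Fm f))"

text \<open>\<open>is_pushout C f g p q\<close>: the cospan \<open>(p, q)\<close> is a pushout of the span \<open>(f, g)\<close>,
  with \<open>p \<cdot> f = q \<cdot> g\<close>.\<close>

definition is_pushout :: "('o, 'm) cat \<Rightarrow> 'm \<Rightarrow> 'm \<Rightarrow> 'm \<Rightarrow> 'm \<Rightarrow> bool" where
  "is_pushout C f g p q \<longleftrightarrow>
     f \<in> Mor C \<and> g \<in> Mor C \<and> p \<in> Mor C \<and> q \<in> Mor C \<and>
     Dom C f = Dom C g \<and> Dom C p = Cod C f \<and> Dom C q = Cod C g \<and> Cod C p = Cod C q \<and>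
     Comp C p f = Comp C q g \<and>
     (\<forall>t \<in> Obj C. \<forall>u \<in> hom C (Cod C f) t. \<forall>v \<in> hom C (Cod C g) t.
        Comp C u f = Comp C v g \<longrightarrow>
        (\<exists>!w. w \<in> hom C (Cod C p) t \<and> Comp C w p = u \<and> Comp C w q = v))"

text \<open>
  A definition cannot quantify over types, so the target categories of functors out of a
  category with morphism type \<open>'m\<close> range over a fixed pair of types, chosen to accommodate the
  category of sets with elements in \<open>'m\<close> (see \<open>set_cat\<close>), and hence all covariant
  hom-functors. The theorem \<open>absolute_pushout_preserved\<close> below shows that this choice is
  immaterial: the pushouts so defined are preserved by every functor to every category,
  of whatever types.
\<close>

type_synonym 'm set_map = "'m set \<times> ('m \<Rightarrow> 'm) \<times> 'm set"

definition absolute_pushout :: "('o, 'm) cat \<Rightarrow> 'm \<Rightarrow> 'm \<Rightarrow> 'm \<Rightarrow> 'm \<Rightarrow> bool" where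
  "absolute_pushout C f g p q \<longleftrightarrow> is_pushout C f g p q \<and>
     (\<forall>(D :: ('m set, 'm set_map) cat) Fo Fm.
        category D \<longrightarrow> is_functor C D Fo Fm \<longrightarrow>
        is_pushout D (Fm f) (Fm g) (Fm p) (Fm q))"

definition has_absolute_pushout :: "('o, 'm) cat \<Rightarrow> 'm \<Rightarrow> 'm \<Rightarrow> bool" where
  "has_absolute_pushout C f g \<longleftrightarrow> (\<exists>p q. absolute_pushout C f g p q)"


subsection \<open>Independence of the choice of target types\<close>

definition set_cat :: "('m set, 'm set_map) cat" where
  "set_cat = \<lparr> Obj = UNIV,
     Mor = {(X, h, Y). h \<in> X \<rightarrow>\<^sub>E Y},
     Dom = fst,
     Cod = (\<lambda>h. snd (snd h)),
     Ident = (\<lambda>X. (X, restrict id X, X)),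
     Comp = (\<lambda>k h. (fst h, compose (fst h) (fst (snd k)) (fst (snd h)), snd (snd k))) \<rparr>"

lemma set_cat_simps:
  "Obj set_cat = UNIV" "Dom set_cat h = fst h" "Cod set_cat h = snd (snd h)"
  "(X, k, Y) \<in> Mor set_cat \<longleftrightarrow> k \<in> X \<rightarrow>\<^sub>E Y"
  "Comp set_cat (Y', l, Z) (X, k, Y) = (X, compose X l k, Z)"
  by (simp_all add: set_cat_def)

lemma hom_set_cat: "h \<in> hom set_cat X Y \<longleftrightarrow> (\<exists>k \<in> X \<rightarrow>\<^sub>E Y. h = (X, k, Y))"
  by (cases h) (auto simp: hom_def set_cat_def)

lemma category_set_cat: "category set_cat"
proof
  show "Comp set_cat (Ident set_cat Y) f = f" if "f \<in> hom set_cat X Y" for f :: "'a set_map" and X Y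
    using that by (auto simp: hom_set_cat) (auto simp: set_cat_def compose_def PiE_iff extensional_def fun_eq_iff)
  show "Comp set_cat f (Ident set_cat X) = f" if "f \<in> hom set_cat X Y" for f :: "'a set_map" and X Y
    using that by (auto simp: hom_set_cat) (auto simp: set_cat_def compose_def PiE_iff extensional_def fun_eq_iff)
  show "Comp set_cat (Comp set_cat h g) f = Comp set_cat h (Comp set_cat g f)"
    if "f \<in> hom set_cat W X" "g \<in> hom set_cat X Y" "h \<in> hom set_cat Y Z"
    for f g h :: "'a set_map" and W X Y Z
    using that by (auto simp: hom_set_cat) (auto simp: set_cat_def compose_def PiE_iff extensional_def fun_eq_iff)
  show "Comp set_cat g f \<in> hom set_cat X Z"
    if "f \<in> hom set_cat X Y" "g \<in> hom set_cat Y Z" for f g :: "'a set_map" and X Y Z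
    using that by (auto simp: hom_set_cat) (auto simp: set_cat_def compose_def PiE_iff extensional_def Pi_iff)
qed (auto simp: set_cat_def hom_def)

definition hom_map :: "('o, 'm) cat \<Rightarrow> 'o \<Rightarrow> 'm \<Rightarrow> 'm set_map" where
  "hom_map C x f = (hom C x (Dom C f), restrict (Comp C f) (hom C x (Dom C f)), hom C x (Cod C f))"

lemma (in category) is_functor_hom:
  "is_functor C set_cat (hom C x) (hom_map C x)"
proof -
  have "hom_map C x f \<in> hom set_cat (hom C x (Dom C f)) (hom C x (Cod C f))" if "f \<in> Mor C" for f
    using that Comp_in[of _ x "Dom C f" f "Cod C f"]
    by (auto simp: hom_set_cat hom_map_def) (auto simp: hom_def)
  moreover have "hom_map C x (Ident C y) = Ident set_cat (hom C x y)" if "y \<in> Obj C" for y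
    using Ident_in[OF that] Ident_left[of _ x y]
    by (auto simp: hom_map_def set_cat_def fun_eq_iff hom_def)
  moreover have "hom_map C x (g \<cdot> f) = Comp set_cat (hom_map C x g) (hom_map C x f)"
    if "f \<in> Mor C" "g \<in> Mor C" "Dom C g = Cod C f" for f g
  proof -
    have f: "f \<in> hom C (Dom C f) (Cod C f)" and g: "g \<in> hom C (Cod C f) (Cod C g)"
      using that by (auto simp: hom_def)
    have gf: "g \<cdot> f \<in> hom C (Dom C f) (Cod C g)"
      by (rule Comp_in[OF f g])
    then have e: "Dom C (g \<cdot> f) = Dom C f" "Cod C (g \<cdot> f) = Cod C g"
      by (auto simp: hom_def)
    have "restrict (Comp C (g \<cdot> f)) (hom C x (Dom C f)) =
        compose (hom C x (Dom C f)) (restrict (Comp C g) (hom C x (Cod C f)))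
          (restrict (Comp C f) (hom C x (Dom C f)))"
      using Comp_in[OF _ f] Comp_assoc[OF _ f g] by (auto simp: fun_eq_iff compose_def)
    then show ?thesis
      by (simp add: hom_map_def set_cat_def e that)
  qed
  ultimately show ?thesis
    unfolding is_functor_def by (auto simp: set_cat_def)
qed

lemma is_pushout_mediating:
  "is_pushout C f g p q \<Longrightarrow> t \<in> Obj C \<Longrightarrow> u \<in> hom C (Cod C f) t \<Longrightarrow> v \<in> hom C (Cod C g) t \<Longrightarrow>
    Comp C u f = Comp C v g \<Longrightarrow> \<exists>!w. w \<in> hom C (Cod C p) t \<and> Comp C w p = u \<and> Comp C w q = v"
  unfolding is_pushout_def by blast

lemma is_pushout_sym: "is_pushout C f g p q \<Longrightarrow> is_pushout C g f q p"
  unfolding is_pushout_def by (metis (no_types, lifting))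

lemma absolute_pushout_sym: "absolute_pushout C f g p q \<Longrightarrow> absolute_pushout C g f q p"
  unfolding absolute_pushout_def by (auto intro: is_pushout_sym)

lemma set_pushout_subset:
  fixes X Y Z W :: "'m set"
  assumes po: "is_pushout set_cat (X, f, Y) (X, g, Z) (Y, p, W) (Z, q, W)"
    and ne: "(c0 :: 'm) \<noteq> c1"
    and ST: "\<And>t. t \<in> X \<Longrightarrow> f t \<in> S \<longleftrightarrow> g t \<in> T"
  shows "\<exists>!h. h \<in> W \<rightarrow>\<^sub>E {c0, c1} \<and> (\<forall>y \<in> Y. h (p y) = (if y \<in> S then c1 else c0))
           \<and> (\<forall>z \<in> Z. h (q z) = (if z \<in> T then c1 else c0))"
proof -
  define u where "u = (\<lambda>y \<in> Y. if y \<in> S then c1 else c0)"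
  define v where "v = (\<lambda>z \<in> Z. if z \<in> T then c1 else c0)"
  have maps: "f \<in> X \<rightarrow>\<^sub>E Y" "g \<in> X \<rightarrow>\<^sub>E Z" "p \<in> Y \<rightarrow>\<^sub>E W" "q \<in> Z \<rightarrow>\<^sub>E W"
    using po by (auto simp: is_pushout_def set_cat_simps)
  have u: "(Y, u, {c0, c1}) \<in> hom set_cat Y {c0, c1}" and v: "(Z, v, {c0, c1}) \<in> hom set_cat Z {c0, c1}"
    by (auto simp: hom_set_cat u_def v_def)
  have comm: "Comp set_cat (Y, u, {c0, c1}) (X, f, Y) = Comp set_cat (Z, v, {c0, c1}) (X, g, Z)"
    using maps ST by (auto simp: set_cat_simps compose_def u_def v_def fun_eq_iff PiE_iff)
  have ex1: "\<exists>!w. w \<in> hom set_cat W {c0, c1} \<and>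
      Comp set_cat w (Y, p, W) = (Y, u, {c0, c1}) \<and> Comp set_cat w (Z, q, W) = (Z, v, {c0, c1})"
    using is_pushout_mediating[OF po, of "{c0, c1}", OF _ _ _ comm] u v
    unfolding set_cat_simps(1-3) fst_conv snd_conv by blast
  have compY: "Comp set_cat (W, h, {c0, c1}) (Y, p, W) = (Y, u, {c0, c1}) \<longleftrightarrow>
      (\<forall>y \<in> Y. h (p y) = (if y \<in> S then c1 else c0))" for h
    by (auto simp: set_cat_simps compose_def u_def fun_eq_iff)
  have compZ: "Comp set_cat (W, h, {c0, c1}) (Z, q, W) = (Z, v, {c0, c1}) \<longleftrightarrow>
      (\<forall>z \<in> Z. h (q z) = (if z \<in> T then c1 else c0))" for h
    by (auto simp: set_cat_simps compose_def v_def fun_eq_iff)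
  from ex1 obtain w where w: "w \<in> hom set_cat W {c0, c1}"
      "Comp set_cat w (Y, p, W) = (Y, u, {c0, c1})" "Comp set_cat w (Z, q, W) = (Z, v, {c0, c1})"
    and uniq: "\<And>w'. w' \<in> hom set_cat W {c0, c1} \<Longrightarrow> Comp set_cat w' (Y, p, W) = (Y, u, {c0, c1}) \<Longrightarrow>
      Comp set_cat w' (Z, q, W) = (Z, v, {c0, c1}) \<Longrightarrow> w' = w"
    by blast
  from w(1) obtain k where k: "k \<in> W \<rightarrow>\<^sub>E {c0, c1}" "w = (W, k, {c0, c1})"
    unfolding hom_set_cat by blast
  show ?thesis
  proof (rule ex1I[of _ k])
    show "k \<in> W \<rightarrow>\<^sub>E {c0, c1} \<and> (\<forall>y \<in> Y. k (p y) = (if y \<in> S then c1 else c0)) \<and>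
        (\<forall>z \<in> Z. k (q z) = (if z \<in> T then c1 else c0))"
      using k(1) w(2,3) unfolding k(2) compY compZ by blast
  next
    fix h
    assume h: "h \<in> W \<rightarrow>\<^sub>E {c0, c1} \<and> (\<forall>y \<in> Y. h (p y) = (if y \<in> S then c1 else c0)) \<and>
        (\<forall>z \<in> Z. h (q z) = (if z \<in> T then c1 else c0))"
    have "(W, h, {c0, c1}) \<in> hom set_cat W {c0, c1}"
      unfolding hom_set_cat using h by blast
    then have "(W, h, {c0, c1}) = w"
      using h unfolding compY[symmetric] compZ[symmetric] by (intro uniq) blast+
    then show "h = k" using k(2) by simp
  qed
qed

context category
begin

lemma absolute_pushout_elements:
  assumes ap: "absolute_pushout C f g p q" and ne: "(c0 :: 'm) \<noteq> c1"
  shows absolute_pushout_surj: "w \<in> hom C x (Cod C p) \<Longrightarrow>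
      (\<exists>y \<in> hom C x (Cod C f). w = p \<cdot> y) \<or> (\<exists>z \<in> hom C x (Cod C g). w = q \<cdot> z)"
    and absolute_pushout_pred: "(\<And>t. t \<in> hom C x (Dom C f) \<Longrightarrow> f \<cdot> t \<in> S \<longleftrightarrow> g \<cdot> t \<in> T) \<Longrightarrow>
      \<exists>U. (\<forall>y \<in> hom C x (Cod C f). p \<cdot> y \<in> U \<longleftrightarrow> y \<in> S) \<and>
          (\<forall>z \<in> hom C x (Cod C g). q \<cdot> z \<in> U \<longleftrightarrow> z \<in> T)"
proof -
  let ?X = "hom C x (Dom C f)" and ?Y = "hom C x (Cod C f)" and ?Z = "hom C x (Cod C g)"
    and ?W = "hom C x (Cod C p)"
  have sq: "Dom C g = Dom C f" "Dom C p = Cod C f" "Dom C q = Cod C g" "Cod C q = Cod C p"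
    "f \<in> Mor C" "g \<in> Mor C" "p \<in> Mor C" "q \<in> Mor C" "p \<cdot> f = q \<cdot> g"
    using ap by (auto simp: absolute_pushout_def is_pushout_def)
  have mem: "f \<in> hom C (Dom C f) (Cod C f)" "g \<in> hom C (Dom C f) (Cod C g)"
    "p \<in> hom C (Cod C f) (Cod C p)" "q \<in> hom C (Cod C g) (Cod C p)"
    using sq by (auto simp: hom_def)
  have "is_pushout set_cat (hom_map C x f) (hom_map C x g) (hom_map C x p) (hom_map C x q)"
    using ap category_set_cat is_functor_hom unfolding absolute_pushout_def by blast
  then have po: "is_pushout set_cat (?X, restrict (Comp C f) ?X, ?Y) (?X, restrict (Comp C g) ?X, ?Z)
      (?Y, restrict (Comp C p) ?Y, ?W) (?Z, restrict (Comp C q) ?Z, ?W)"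
    by (simp add: hom_map_def sq)
  show "(\<exists>y \<in> ?Y. w = p \<cdot> y) \<or> (\<exists>z \<in> ?Z. w = q \<cdot> z)" if w: "w \<in> ?W"
  proof (rule ccontr)
    assume n: "\<not> ?thesis"
    let ?h1 = "\<lambda>v \<in> ?W. c1" and ?h2 = "\<lambda>v \<in> ?W. if v = w then c0 else c1"
    have "\<exists>!h. h \<in> ?W \<rightarrow>\<^sub>E {c0, c1} \<and>
        (\<forall>y \<in> ?Y. h (restrict (Comp C p) ?Y y) = (if y \<in> ?Y then c1 else c0)) \<and>
        (\<forall>z \<in> ?Z. h (restrict (Comp C q) ?Z z) = (if z \<in> ?Z then c1 else c0))"
      by (rule set_pushout_subset[OF po ne]) (simp add: Comp_in[OF _ mem(1)] Comp_in[OF _ mem(2)])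
    moreover have "?h1 \<in> ?W \<rightarrow>\<^sub>E {c0, c1} \<and>
        (\<forall>y \<in> ?Y. ?h1 (restrict (Comp C p) ?Y y) = (if y \<in> ?Y then c1 else c0)) \<and>
        (\<forall>z \<in> ?Z. ?h1 (restrict (Comp C q) ?Z z) = (if z \<in> ?Z then c1 else c0))"
      using Comp_in[OF _ mem(3)] Comp_in[OF _ mem(4)] by auto
    moreover have "?h2 \<in> ?W \<rightarrow>\<^sub>E {c0, c1} \<and>
        (\<forall>y \<in> ?Y. ?h2 (restrict (Comp C p) ?Y y) = (if y \<in> ?Y then c1 else c0)) \<and>
        (\<forall>z \<in> ?Z. ?h2 (restrict (Comp C q) ?Z z) = (if z \<in> ?Z then c1 else c0))"
      using Comp_in[OF _ mem(3)] Comp_in[OF _ mem(4)] n by auto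
    ultimately have "?h1 = ?h2" by blast
    then have "?h1 w = ?h2 w" by (rule fun_cong)
    then show False using w ne by simp
  qed
  show "\<exists>U. (\<forall>y \<in> ?Y. p \<cdot> y \<in> U \<longleftrightarrow> y \<in> S) \<and> (\<forall>z \<in> ?Z. q \<cdot> z \<in> U \<longleftrightarrow> z \<in> T)"
    if ST: "\<And>t. t \<in> ?X \<Longrightarrow> f \<cdot> t \<in> S \<longleftrightarrow> g \<cdot> t \<in> T"
  proof -
    have "\<exists>!h. h \<in> ?W \<rightarrow>\<^sub>E {c0, c1} \<and>
        (\<forall>y \<in> ?Y. h (restrict (Comp C p) ?Y y) = (if y \<in> S then c1 else c0)) \<and>
        (\<forall>z \<in> ?Z. h (restrict (Comp C q) ?Z z) = (if z \<in> T then c1 else c0))"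
      by (rule set_pushout_subset[OF po ne]) (simp add: ST)
    then obtain h where "\<forall>y \<in> ?Y. h (p \<cdot> y) = (if y \<in> S then c1 else c0)"
      "\<forall>z \<in> ?Z. h (q \<cdot> z) = (if z \<in> T then c1 else c0)"
      by auto
    then show ?thesis
      using ne by (intro exI[of _ "{v. h v = c1}"]) auto
  qed
qed

lemma absolute_pushout_mediating:
  fixes D :: "('p, 'n) cat"
  assumes ap: "absolute_pushout C f g p q" and ne: "(c0 :: 'm) \<noteq> c1"
    and D: "category D" and F: "is_functor C D Fo Fm"
    and u: "u \<in> hom D (Fo (Cod C f)) t" and v: "v \<in> hom D (Fo (Cod C g)) t"
    and uv: "Comp D u (Fm f) = Comp D v (Fm g)"
    and y: "y \<in> hom C (Cod C p) (Cod C f)" "Ident C (Cod C p) = p \<cdot> y"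
  shows "\<exists>!w. w \<in> hom D (Fo (Cod C p)) t \<and> Comp D w (Fm p) = u \<and> Comp D w (Fm q) = v"
proof -
  interpret D: category D by (rule D)
  have sq: "Dom C g = Dom C f" "Dom C p = Cod C f" "Dom C q = Cod C g" "Cod C q = Cod C p"
    "f \<in> Mor C" "g \<in> Mor C" "p \<in> Mor C" "q \<in> Mor C"
    using ap by (auto simp: absolute_pushout_def is_pushout_def)
  have mem: "f \<in> hom C (Dom C f) (Cod C f)" "g \<in> hom C (Dom C f) (Cod C g)"
    "p \<in> hom C (Cod C f) (Cod C p)" "q \<in> hom C (Cod C g) (Cod C p)"
    using sq by (auto simp: hom_def)
  have Fhom: "Fm k \<in> hom D (Fo a) (Fo b)" if "k \<in> hom C a b" for k a b
    using F that by (auto simp: is_functor_def hom_def)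
  have Fcomp: "Fm (l \<cdot> k) = Comp D (Fm l) (Fm k)" if "k \<in> hom C a b" "l \<in> hom C b c" for k l a b c
    using F that by (auto simp: is_functor_def hom_def)
  have Fid: "Fm (Ident C a) = Ident D (Fo a)" if "a \<in> Obj C" for a
    using F that by (auto simp: is_functor_def)
  have cond: "f \<cdot> k \<in> {y. Comp D u (Fm y) = c} \<longleftrightarrow> g \<cdot> k \<in> {z. Comp D v (Fm z) = c}"
    if k: "k \<in> hom C x (Dom C f)" for x k c
  proof -
    have "Comp D u (Fm (f \<cdot> k)) = Comp D (Comp D u (Fm f)) (Fm k)"
      using Fcomp[OF k mem(1)] D.Comp_assoc[OF Fhom[OF k] Fhom[OF mem(1)] u] by simp
    also have "\<dots> = Comp D v (Fm (g \<cdot> k))"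
      using Fcomp[OF k mem(2)] D.Comp_assoc[OF Fhom[OF k] Fhom[OF mem(2)] v] uv by simp
    finally show ?thesis by simp
  qed
  have pp: "Comp D u (Fm y1) = Comp D u (Fm y2)"
    if "y1 \<in> hom C x (Cod C f)" "y2 \<in> hom C x (Cod C f)" "p \<cdot> y1 = p \<cdot> y2" for x y1 y2
  proof -
    have "\<exists>U. (\<forall>y \<in> hom C x (Cod C f). p \<cdot> y \<in> U \<longleftrightarrow> y \<in> {y. Comp D u (Fm y) = Comp D u (Fm y2)}) \<and>
        (\<forall>z \<in> hom C x (Cod C g). q \<cdot> z \<in> U \<longleftrightarrow> z \<in> {z. Comp D v (Fm z) = Comp D u (Fm y2)})"
      by (rule absolute_pushout_pred[OF ap ne]) (rule cond)
    then obtain U where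
      U: "\<And>y. y \<in> hom C x (Cod C f) \<Longrightarrow> p \<cdot> y \<in> U \<longleftrightarrow> Comp D u (Fm y) = Comp D u (Fm y2)"
        "\<And>z. z \<in> hom C x (Cod C g) \<Longrightarrow> q \<cdot> z \<in> U \<longleftrightarrow> Comp D v (Fm z) = Comp D u (Fm y2)"
      by auto
    show ?thesis using U(1)[OF that(1)] U(1)[OF that(2)] that(3) by simp
  qed
  have pq: "Comp D u (Fm y1) = Comp D v (Fm z)"
    if "y1 \<in> hom C x (Cod C f)" "z \<in> hom C x (Cod C g)" "p \<cdot> y1 = q \<cdot> z" for x y1 z
  proof -
    have "\<exists>U. (\<forall>y \<in> hom C x (Cod C f). p \<cdot> y \<in> U \<longleftrightarrow> y \<in> {y. Comp D u (Fm y) = Comp D u (Fm y1)}) \<and>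
        (\<forall>z \<in> hom C x (Cod C g). q \<cdot> z \<in> U \<longleftrightarrow> z \<in> {z. Comp D v (Fm z) = Comp D u (Fm y1)})"
      by (rule absolute_pushout_pred[OF ap ne]) (rule cond)
    then obtain U where
      U: "\<And>y. y \<in> hom C x (Cod C f) \<Longrightarrow> p \<cdot> y \<in> U \<longleftrightarrow> Comp D u (Fm y) = Comp D u (Fm y1)"
        "\<And>z. z \<in> hom C x (Cod C g) \<Longrightarrow> q \<cdot> z \<in> U \<longleftrightarrow> Comp D v (Fm z) = Comp D u (Fm y1)"
      by auto
    show ?thesis using U(1)[OF that(1)] U(2)[OF that(2)] that(3) by simp
  qed
  have objs: "Cod C f \<in> Obj C" "Cod C g \<in> Obj C" "Cod C p \<in> Obj C"
    using sq Cod_in by auto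
  define w where "w = Comp D u (Fm y)"
  have w: "w \<in> hom D (Fo (Cod C p)) t"
    unfolding w_def by (rule D.Comp_in[OF Fhom[OF y(1)] u])
  have "p \<cdot> (y \<cdot> p) = p \<cdot> Ident C (Cod C f)"
    using Comp_assoc[OF mem(3) y(1) mem(3)] y(2) Ident_left[OF mem(3)] Ident_right[OF mem(3)] by simp
  then have "Comp D u (Fm (y \<cdot> p)) = Comp D u (Fm (Ident C (Cod C f)))"
    using Comp_in[OF mem(3) y(1)] Ident_in[OF objs(1)] by (rule pp[rotated 2])
  then have wp: "Comp D w (Fm p) = u"
    using D.Comp_assoc[OF Fhom[OF mem(3)] Fhom[OF y(1)] u] Fcomp[OF mem(3) y(1)]
      Fid[OF objs(1)] D.Ident_right[OF u] by (simp add: w_def)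
  have "p \<cdot> (y \<cdot> q) = q \<cdot> Ident C (Cod C g)"
    using Comp_assoc[OF mem(4) y(1) mem(3)] y(2) Ident_left[OF mem(4)] Ident_right[OF mem(4)] by simp
  then have "Comp D u (Fm (y \<cdot> q)) = Comp D v (Fm (Ident C (Cod C g)))"
    using Comp_in[OF mem(4) y(1)] Ident_in[OF objs(2)] by (rule pq[rotated 2])
  then have wq: "Comp D w (Fm q) = v"
    using D.Comp_assoc[OF Fhom[OF mem(4)] Fhom[OF y(1)] u] Fcomp[OF mem(4) y(1)]
      Fid[OF objs(2)] D.Ident_right[OF v] by (simp add: w_def)
  have "w' = w" if w': "w' \<in> hom D (Fo (Cod C p)) t" and "Comp D w' (Fm p) = u" for w'
  proof -
    have "w' = Comp D w' (Fm (p \<cdot> y))"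
      using y(2) Fid[OF objs(3)] D.Ident_right[OF w'] by metis
    also have "\<dots> = Comp D (Comp D w' (Fm p)) (Fm y)"
      using Fcomp[OF y(1) mem(3)] D.Comp_assoc[OF Fhom[OF y(1)] Fhom[OF mem(3)] w'] by simp
    finally show ?thesis using that by (simp add: w_def)
  qed
  with w wp wq show ?thesis by blast
qed

theorem absolute_pushout_preserved:
  fixes D :: "('p, 'n) cat"
  assumes ap: "absolute_pushout C f g p q"
    and D: "category D" and F: "is_functor C D Fo Fm"
  shows "is_pushout D (Fm f) (Fm g) (Fm p) (Fm q)"
proof -
  interpret D: category D by (rule D)
  have sq: "Dom C g = Dom C f" "Dom C p = Cod C f" "Dom C q = Cod C g" "Cod C q = Cod C p"
    "f \<in> Mor C" "g \<in> Mor C" "p \<in> Mor C" "q \<in> Mor C" "p \<cdot> f = q \<cdot> g"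
    using ap by (auto simp: absolute_pushout_def is_pushout_def)
  have mem: "f \<in> hom C (Dom C f) (Cod C f)" "g \<in> hom C (Dom C f) (Cod C g)"
    "p \<in> hom C (Cod C f) (Cod C p)" "q \<in> hom C (Cod C g) (Cod C p)"
    using sq by (auto simp: hom_def)
  have Fhom: "Fm k \<in> hom D (Fo a) (Fo b)" if "k \<in> hom C a b" for k a b
    using F that by (auto simp: is_functor_def hom_def)
  have Fcomp: "Fm (l \<cdot> k) = Comp D (Fm l) (Fm k)" if "k \<in> hom C a b" "l \<in> hom C b c" for k l a b c
    using F that by (auto simp: is_functor_def hom_def)
  have Fmem: "Fm f \<in> hom D (Fo (Dom C f)) (Fo (Cod C f))" "Fm g \<in> hom D (Fo (Dom C f)) (Fo (Cod C g))"
    "Fm p \<in> hom D (Fo (Cod C f)) (Fo (Cod C p))" "Fm q \<in> hom D (Fo (Cod C g)) (Fo (Cod C p))"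
    using Fhom mem by auto
  have comm: "Comp D (Fm p) (Fm f) = Comp D (Fm q) (Fm g)"
    using Fcomp[OF mem(1,3)] Fcomp[OF mem(2,4)] sq by simp
  have med: "\<exists>!w. w \<in> hom D (Fo (Cod C p)) t \<and> Comp D w (Fm p) = u \<and> Comp D w (Fm q) = v"
    if u: "u \<in> hom D (Fo (Cod C f)) t" and v: "v \<in> hom D (Fo (Cod C g)) t"
      and uv: "Comp D u (Fm f) = Comp D v (Fm g)" for t u v
  proof (cases "\<exists>c0 c1 :: 'm. c0 \<noteq> c1")
    case True
    then obtain c0 c1 :: 'm where ne: "c0 \<noteq> c1" by blast
    have P: "Cod C p \<in> Obj C" using sq Cod_in by auto
    from absolute_pushout_surj[OF ap ne Ident_in[OF P]] show ?thesis
    proof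
      assume "\<exists>y \<in> hom C (Cod C p) (Cod C f). Ident C (Cod C p) = p \<cdot> y"
      then show ?thesis
        using absolute_pushout_mediating[OF ap ne D F u v uv] by blast
    next
      assume "\<exists>z \<in> hom C (Cod C p) (Cod C g). Ident C (Cod C p) = q \<cdot> z"
      then obtain z where "z \<in> hom C (Cod C q) (Cod C g)" "Ident C (Cod C q) = q \<cdot> z"
        using sq by auto
      then have "\<exists>!w. w \<in> hom D (Fo (Cod C q)) t \<and> Comp D w (Fm q) = v \<and> Comp D w (Fm p) = u"
        using absolute_pushout_mediating[OF absolute_pushout_sym[OF ap] ne D F v u uv[symmetric]]
        by blast
      then show ?thesis using sq by (simp add: conj_commute)
    qed
  next
    case False
    then have eq: "a = b" for a b :: 'm by blast
    have P: "Cod C p \<in> Obj C" using sq Cod_in by auto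
    have id: "k = Ident C (Cod C p)" for k by (rule eq)
    have o: "Cod C f = Cod C p" "Cod C g = Cod C p"
      using eq[of f p] eq[of g p] by auto
    have Fk: "Fm k = Ident D (Fo (Cod C p))" for k
      using F P unfolding is_functor_def by (subst id[of k]) blast
    have "v = u"
      using uv D.Ident_right[OF u] D.Ident_right[OF v] Fk o by metis
    moreover have "Comp D k (Ident D (Fo (Cod C p))) = k" if "k \<in> hom D (Fo (Cod C p)) t" for k
      using D.Ident_right that by blast
    ultimately show ?thesis
      using u unfolding Fk o by (intro ex1I[of _ u]) auto
  qed
  have "Dom D (Fm f) = Dom D (Fm g)" "Dom D (Fm p) = Cod D (Fm f)" "Dom D (Fm q) = Cod D (Fm g)"
    "Cod D (Fm p) = Cod D (Fm q)" "Cod D (Fm f) = Fo (Cod C f)" "Cod D (Fm g) = Fo (Cod C g)"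
    "Cod D (Fm p) = Fo (Cod C p)"
    "Fm f \<in> Mor D" "Fm g \<in> Mor D" "Fm p \<in> Mor D" "Fm q \<in> Mor D"
    using Fmem by (auto simp: hom_def)
  then show ?thesis
    unfolding is_pushout_def using comm med by simp
qed

end


section \<open>Orthogonal factorization systems\<close>

text \<open>\<open>orthogonal C l r\<close>: every commutative square from \<open>l\<close> to \<open>r\<close> has exactly one diagonal
  filler.\<close>

definition orthogonal :: "('o, 'm) cat \<Rightarrow> 'm \<Rightarrow> 'm \<Rightarrow> bool" where
  "orthogonal C l r \<longleftrightarrow>
     (\<forall>u \<in> hom C (Dom C l) (Dom C r). \<forall>v \<in> hom C (Cod C l) (Cod C r).
        Comp C r u = Comp C v l \<longrightarrow>
        (\<exists>!d. d \<in> hom C (Cod C l) (Dom C r) \<and> Comp C d l = u \<and> Comp C r d = v))"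

definition orthogonal_factorization_system ::
    "('o, 'm) cat \<Rightarrow> 'm set \<Rightarrow> 'm set \<Rightarrow> bool" where
  "orthogonal_factorization_system C L R \<longleftrightarrow>
     L = {l \<in> Mor C. \<forall>r \<in> R. orthogonal C l r} \<and>
     R = {r \<in> Mor C. \<forall>l \<in> L. orthogonal C l r} \<and>
     (\<forall>f \<in> Mor C. \<exists>l \<in> L. \<exists>r \<in> R. Dom C r = Cod C l \<and> f = Comp C r l)"


section \<open>Reedy and Eilenberg--Zilber categories\<close>

locale generalized_reedy = category A
  for A :: "('o, 'm) cat" +
  fixes deg :: "'o \<Rightarrow> nat" and A_minus A_plus :: "'m set"
  assumes deg_iso: "x \<in> Obj A \<Longrightarrow> y \<in> Obj A \<Longrightarrow> isomorphic_objects A x y \<Longrightarrow> deg x = deg y"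
    and ofs: "orthogonal_factorization_system A A_minus A_plus"
    and minus_lowers: "f \<in> A_minus \<Longrightarrow> \<not> isomorphism A f \<Longrightarrow> deg (Cod A f) < deg (Dom A f)"
    and plus_raises: "f \<in> A_plus \<Longrightarrow> \<not> isomorphism A f \<Longrightarrow> deg (Dom A f) < deg (Cod A f)"

locale eilenberg_zilber = generalized_reedy A deg A_minus A_plus
  for A :: "('o, 'm) cat" and deg A_minus A_plus +
  assumes minus_absolute_pushout:
    "f \<in> A_minus \<Longrightarrow> g \<in> A_minus \<Longrightarrow> Dom A f = Dom A g \<Longrightarrow> has_absolute_pushout A f g"

locale berger_moerdijk_ez = category A
  for A :: "('o, 'm) cat" +
  fixes deg :: "'o \<Rightarrow> nat"
  assumes mono_preserves_deg:
      "monomorphism A m \<Longrightarrow> deg (Cod A m) = deg (Dom A m) \<longleftrightarrow> isomorphism A m"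
    and mono_raises_deg:
      "monomorphism A m \<Longrightarrow> deg (Dom A m) < deg (Cod A m) \<longleftrightarrow> \<not> isomorphism A m"
    and split_epi_mono_factorization:
      "f \<in> Mor A \<Longrightarrow> \<exists>e m. split_epimorphism A e \<and> monomorphism A m \<and>
         Dom A m = Cod A e \<and> f = Comp A m e"
    and split_epi_absolute_pushout:
      "split_epimorphism A f \<Longrightarrow> split_epimorphism A g \<Longrightarrow> Dom A f = Dom A g \<Longrightarrow>
         has_absolute_pushout A f g"

end

theory Submission
  imports Defs
begin

text \<open>
  The crux is that a morphism \<open>f\<close> having an absolute pushout \<open>(p, q)\<close> with itself is a split
  epimorphism. Absoluteness makes every generalised element of the pushout come from a leg, so the
  identity does, and the codiagonal then forces \<open>p = q\<close>. The pushout is preserved by the functor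
  represented by the codomain of \<open>f\<close>, so \<open>p = q\<close> makes that functor send \<open>f\<close> to a surjection,
  and a preimage of the identity is a section. Hence
  \<open>A_minus\<close> consists of split epimorphisms. As split epimorphisms are orthogonal to
  monomorphisms, both classes of the factorization system are then determined by orthogonality.
\<close>

section \<open>Monomorphisms and split epimorphisms in a category\<close>

context category
begin

lemma Mor_hom: "f \<in> Mor C \<Longrightarrow> f \<in> hom C (Dom C f) (Cod C f)"
  by (simp add: hom_def)

lemma Comp_props:
  assumes "f \<in> Mor C" "g \<in> Mor C" "Dom C g = Cod C f"
  shows "g \<cdot> f \<in> Mor C" "Dom C (g \<cdot> f) = Dom C f" "Cod C (g \<cdot> f) = Cod C g"
  using Comp_in[of f "Dom C f" "Cod C f" g "Cod C g"] assms by (auto simp: hom_def)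

lemma assoc:
  assumes "f \<in> Mor C" "g \<in> Mor C" "h \<in> Mor C" "Dom C g = Cod C f" "Dom C h = Cod C g"
  shows "(h \<cdot> g) \<cdot> f = h \<cdot> (g \<cdot> f)"
  using Comp_assoc[of f "Dom C f" "Cod C f" g "Cod C g" h "Cod C h"] assms by (auto simp: hom_def)

lemma unit_laws:
  assumes "f \<in> Mor C"
  shows "Ident C (Cod C f) \<cdot> f = f" "f \<cdot> Ident C (Dom C f) = f"
  using Ident_left[OF Mor_hom[OF assms]] Ident_right[OF Mor_hom[OF assms]] by auto

lemma left_inverse_mono:
  assumes "m \<in> Mor C" "d \<in> hom C (Cod C m) (Dom C m)" "d \<cdot> m = Ident C (Dom C m)"
  shows "monomorphism C m"
  unfolding monomorphism_def
proof (intro conjI ballI impI)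
  have "d \<cdot> (m \<cdot> k) = k" if "k \<in> hom C x (Dom C m)" for k x
    using Comp_assoc[OF that Mor_hom[OF assms(1)] assms(2)] assms(3) Ident_left[OF that] by simp
  then show "g = h" if "g \<in> hom C x (Dom C m)" "h \<in> hom C x (Dom C m)" "m \<cdot> g = m \<cdot> h" for x g h
    using that by metis
qed (rule assms)

lemma iso_mono: "isomorphism C f \<Longrightarrow> monomorphism C f"
  unfolding isomorphism_def using left_inverse_mono by blast

lemma split_epi_cancel:
  assumes "split_epimorphism C e" "u \<in> hom C (Cod C e) x" "v \<in> hom C (Cod C e) x" "u \<cdot> e = v \<cdot> e"
  shows "u = v"
proof -
  obtain s where s: "s \<in> hom C (Cod C e) (Dom C e)" "e \<cdot> s = Ident C (Cod C e)" and e: "e \<in> Mor C"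
    using assms(1) unfolding split_epimorphism_def by blast
  have "w \<cdot> e \<cdot> s = w" if "w \<in> hom C (Cod C e) x" for w
    using Comp_assoc[OF s(1) Mor_hom[OF e] that] s(2) Ident_right[OF that] by simp
  then show ?thesis
    using assms(2-4) by metis
qed

text \<open>Cancelling \<open>e\<close> in \<open>e \<cdot> (s \<cdot> e) = e\<close> makes its
  section \<open>s\<close> a two-sided inverse.\<close>

lemma mono_split_epi_iso:
  assumes "split_epimorphism C e" "monomorphism C e"
  shows "isomorphism C e"
proof -
  obtain s where s: "s \<in> hom C (Cod C e) (Dom C e)" "e \<cdot> s = Ident C (Cod C e)" and e: "e \<in> Mor C"
    using assms(1) unfolding split_epimorphism_def by blast
  have "e \<cdot> (s \<cdot> e) = e \<cdot> Ident C (Dom C e)"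
    using Comp_assoc[OF Mor_hom[OF e] s(1) Mor_hom[OF e]] s(2) unit_laws[OF e] by simp
  moreover have "s \<cdot> e \<in> hom C (Dom C e) (Dom C e)" "Ident C (Dom C e) \<in> hom C (Dom C e) (Dom C e)"
    using Comp_in[OF Mor_hom[OF e] s(1)] Ident_in Dom_in[OF e] by auto
  ultimately have "s \<cdot> e = Ident C (Dom C e)"
    using assms(2) Dom_in[OF e] unfolding monomorphism_def by blast
  then show ?thesis
    using e s unfolding isomorphism_def by blast
qed

lemma section_mono:
  assumes "e \<in> Mor C" "s \<in> hom C (Cod C e) (Dom C e)" "e \<cdot> s = Ident C (Cod C e)"
  shows "monomorphism C s"
  using assms by (intro left_inverse_mono[of s e]) (auto simp: hom_def)

text \<open>The inverse of \<open>s\<close> must be \<open>e\<close>, so \<open>s\<close> is also a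
  left inverse of \<open>e\<close>. This lets degree information about a section decide whether its
  retraction is mono.\<close>

lemma retraction_of_iso_mono:
  assumes e: "e \<in> Mor C" and s: "s \<in> hom C (Cod C e) (Dom C e)"
    and es: "e \<cdot> s = Ident C (Cod C e)" and iso: "isomorphism C s"
  shows "monomorphism C e"
proof -
  have ds: "Dom C s = Cod C e" "Cod C s = Dom C e" "s \<in> Mor C" using s by (auto simp: hom_def)
  obtain t where t: "t \<in> hom C (Dom C e) (Cod C e)" "s \<cdot> t = Ident C (Dom C e)"
    using iso unfolding isomorphism_def ds by blast
  have "e = (e \<cdot> s) \<cdot> t"
    using Comp_assoc[OF t(1) s Mor_hom[OF e]] t(2) unit_laws[OF e] by simp
  also have "\<dots> = t"
    using es Ident_left[OF t(1)] by simp
  finally show ?thesis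
    using left_inverse_mono[OF e s] t(2) by simp
qed

lemma mono_comp:
  assumes f: "monomorphism C f" and g: "monomorphism C g" and "Dom C g = Cod C f"
  shows "monomorphism C (g \<cdot> f)"
  unfolding monomorphism_def
proof (intro conjI ballI impI)
  have mor: "f \<in> Mor C" "g \<in> Mor C"
    using f g by (auto simp: monomorphism_def)
  note gf = Comp_props[OF mor assms(3)]
  show "g \<cdot> f \<in> Mor C" by (rule gf)
  fix x a b
  assume x: "x \<in> Obj C" and a: "a \<in> hom C x (Dom C (g \<cdot> f))" and b: "b \<in> hom C x (Dom C (g \<cdot> f))"
    and eq: "g \<cdot> f \<cdot> a = g \<cdot> f \<cdot> b"
  have ab: "a \<in> hom C x (Dom C f)" "b \<in> hom C x (Dom C f)"
    using a b gf by auto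
  have "g \<cdot> (f \<cdot> a) = g \<cdot> (f \<cdot> b)"
    using eq ab mor assms(3) by (auto simp: assoc hom_def)
  moreover have "f \<cdot> a \<in> hom C x (Dom C g)" "f \<cdot> b \<in> hom C x (Dom C g)"
    using Comp_in[OF ab(1) Mor_hom[OF mor(1)]] Comp_in[OF ab(2) Mor_hom[OF mor(1)]] assms(3) by auto
  ultimately have "f \<cdot> a = f \<cdot> b"
    using g x unfolding monomorphism_def by blast
  then show "a = b"
    using f x ab unfolding monomorphism_def by blast
qed

lemma split_epi_comp:
  assumes f: "split_epimorphism C f" and g: "split_epimorphism C g" and dg: "Dom C g = Cod C f"
  shows "split_epimorphism C (g \<cdot> f)"
proof -
  obtain s where s: "s \<in> hom C (Cod C f) (Dom C f)" "f \<cdot> s = Ident C (Cod C f)" and fM: "f \<in> Mor C"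
    using f unfolding split_epimorphism_def by blast
  obtain t where t: "t \<in> hom C (Cod C g) (Cod C f)" "g \<cdot> t = Ident C (Cod C g)" and gM: "g \<in> Mor C"
    using g dg unfolding split_epimorphism_def by auto
  note gf = Comp_props[OF fM gM dg]
  have st: "s \<cdot> t \<in> hom C (Cod C g) (Dom C f)"
    using Comp_in[OF t(1) s(1)] .
  have "g \<cdot> f \<cdot> (s \<cdot> t) = g \<cdot> (f \<cdot> (s \<cdot> t))"
    using st fM gM dg by (auto simp: assoc hom_def)
  also have "f \<cdot> (s \<cdot> t) = t"
    using Comp_assoc[OF t(1) s(1) Mor_hom[OF fM]] s(2) Ident_left[OF t(1)] by simp
  finally show ?thesis
    using gf st t(2) unfolding split_epimorphism_def by auto
qed

section \<open>Orthogonality and the split epi-mono factorization system\<close>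

text \<open>The filler is \<open>u \<cdot> s\<close> for a section \<open>s\<close> of
  \<open>e\<close>. Cancelling \<open>m\<close> gives the triangle at \<open>e\<close>, and
  cancelling \<open>e\<close> gives uniqueness.\<close>

lemma split_epi_orthogonal_mono:
  assumes e: "split_epimorphism C e" and m: "monomorphism C m"
  shows "orthogonal C e m"
  unfolding orthogonal_def
proof (intro ballI impI)
  obtain s where s: "s \<in> hom C (Cod C e) (Dom C e)" "e \<cdot> s = Ident C (Cod C e)" and eM: "e \<in> Mor C"
    using e unfolding split_epimorphism_def by blast
  have mM: "m \<in> Mor C"
    using m by (simp add: monomorphism_def)
  fix u v
  assume u: "u \<in> hom C (Dom C e) (Dom C m)" and v: "v \<in> hom C (Cod C e) (Cod C m)"
    and sq: "m \<cdot> u = v \<cdot> e"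
  have d: "u \<cdot> s \<in> hom C (Cod C e) (Dom C m)"
    by (rule Comp_in[OF s(1) u])
  have md: "m \<cdot> (u \<cdot> s) = v"
    using Comp_assoc[OF s(1) u Mor_hom[OF mM]] Comp_assoc[OF s(1) Mor_hom[OF eM] v] sq s(2)
      Ident_right[OF v] by simp
  have "m \<cdot> (u \<cdot> s \<cdot> e) = m \<cdot> u"
    using Comp_assoc[OF Mor_hom[OF eM] d Mor_hom[OF mM]] md sq by simp
  then have de: "u \<cdot> s \<cdot> e = u"
    using m u Comp_in[OF Mor_hom[OF eM] d] Dom_in[OF eM] unfolding monomorphism_def by blast
  show "\<exists>!d. d \<in> hom C (Cod C e) (Dom C m) \<and> d \<cdot> e = u \<and> m \<cdot> d = v"
    using d md de split_epi_cancel[OF e] by (intro ex1I[of _ "u \<cdot> s"]) auto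
qed

lemma orthogonal_fillE:
  assumes "orthogonal C l r" "u \<in> hom C (Dom C l) (Dom C r)" "v \<in> hom C (Cod C l) (Cod C r)"
    and "r \<cdot> u = v \<cdot> l"
  obtains d where "d \<in> hom C (Cod C l) (Dom C r)" "d \<cdot> l = u" "r \<cdot> d = v"
proof -
  have "\<exists>!d. d \<in> hom C (Cod C l) (Dom C r) \<and> d \<cdot> l = u \<and> r \<cdot> d = v"
    using assms unfolding orthogonal_def by blast
  then show thesis
    by (elim ex1E conjE) (rule that)
qed

text \<open>The filler of the square with an identity on top and \<open>r\<close> at the bottom is
  the left inverse.\<close>

lemma orthogonal_fill_left:
  assumes l: "l \<in> Mor C" and r: "r \<in> Mor C" and "Dom C r = Cod C l"
    and "orthogonal C l (r \<cdot> l)"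
  obtains d where "d \<in> hom C (Cod C l) (Dom C l)" "d \<cdot> l = Ident C (Dom C l)"
proof -
  note rl = Comp_props[OF l r assms(3)]
  have "Ident C (Dom C l) \<in> hom C (Dom C l) (Dom C (r \<cdot> l))" "r \<in> hom C (Cod C l) (Cod C (r \<cdot> l))"
    "r \<cdot> l \<cdot> Ident C (Dom C l) = r \<cdot> l"
    using rl Ident_in[OF Dom_in[OF l]] assms(3) r unit_laws[OF rl(1)] by (auto simp: hom_def)
  then show thesis
    using orthogonal_fillE[OF assms(4)] that unfolding rl(2) by metis
qed

text \<open>Dually, the square has \<open>l\<close> on top and an identity at the bottom.\<close>

lemma orthogonal_fill_right:
  assumes l: "l \<in> Mor C" and r: "r \<in> Mor C" and "Dom C r = Cod C l"
    and "orthogonal C (r \<cdot> l) r"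
  obtains d where "d \<in> hom C (Cod C r) (Dom C r)" "r \<cdot> d = Ident C (Cod C r)"
proof -
  note rl = Comp_props[OF l r assms(3)]
  have "l \<in> hom C (Dom C (r \<cdot> l)) (Dom C r)" "Ident C (Cod C r) \<in> hom C (Cod C (r \<cdot> l)) (Cod C r)"
    "r \<cdot> l = Ident C (Cod C r) \<cdot> (r \<cdot> l)"
    using rl Ident_in[OF Cod_in[OF r]] assms(3) l unit_laws[OF rl(1)] by (auto simp: hom_def)
  then show thesis
    using orthogonal_fillE[OF assms(4)] that unfolding rl(3) by metis
qed

text \<open>Retract argument: a morphism orthogonal to its own mono part makes that part a split
  epimorphism, and a composite of split epimorphisms is split. Dually, a morphism to which its own
  split epi part is orthogonal has that part mono, hence is a composite of monomorphisms.\<close>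

lemma split_epi_mono_ofs:
  assumes fact: "\<And>f. f \<in> Mor C \<Longrightarrow> \<exists>e m. split_epimorphism C e \<and> monomorphism C m \<and>
         Dom C m = Cod C e \<and> f = m \<cdot> e"
  shows "orthogonal_factorization_system C {e. split_epimorphism C e} {m. monomorphism C m}"
proof -
  have left: "split_epimorphism C l"
    if l: "l \<in> Mor C" and orth: "\<And>r. monomorphism C r \<Longrightarrow> orthogonal C l r" for l
  proof -
    obtain e m where em: "split_epimorphism C e" "monomorphism C m" "Dom C m = Cod C e" "l = m \<cdot> e"
      using fact[OF l] by blast
    have mor: "e \<in> Mor C" "m \<in> Mor C"
      using em by (auto simp: split_epimorphism_def monomorphism_def)
    have "split_epimorphism C m"
      using orthogonal_fill_right[OF mor em(3)] orth[OF em(2)] em(4) mor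
      unfolding split_epimorphism_def by blast
    then show ?thesis
      using split_epi_comp[OF em(1) _ em(3)] em(4) by simp
  qed
  have right: "monomorphism C r"
    if r: "r \<in> Mor C" and orth: "\<And>l. split_epimorphism C l \<Longrightarrow> orthogonal C l r" for r
  proof -
    obtain e m where em: "split_epimorphism C e" "monomorphism C m" "Dom C m = Cod C e" "r = m \<cdot> e"
      using fact[OF r] by blast
    have mor: "e \<in> Mor C" "m \<in> Mor C"
      using em by (auto simp: split_epimorphism_def monomorphism_def)
    have "monomorphism C e"
      using orthogonal_fill_left[OF mor em(3)] orth[OF em(1)] em(4) left_inverse_mono[OF mor(1)]
      by blast
    then show ?thesis
      using mono_comp[OF _ em(2,3)] em(4) by simp
  qed
  have mor: "e \<in> Mor C" if "split_epimorphism C e" for e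
    using that by (simp add: split_epimorphism_def)
  have mor': "m \<in> Mor C" if "monomorphism C m" for m
    using that by (simp add: monomorphism_def)
  show ?thesis
    unfolding orthogonal_factorization_system_def
  proof (intro conjI)
    show "{e. split_epimorphism C e} = {l \<in> Mor C. \<forall>r \<in> {m. monomorphism C m}. orthogonal C l r}"
      using left split_epi_orthogonal_mono mor by blast
    show "{m. monomorphism C m} = {r \<in> Mor C. \<forall>l \<in> {e. split_epimorphism C e}. orthogonal C l r}"
      using right split_epi_orthogonal_mono mor' by blast
    show "\<forall>f \<in> Mor C. \<exists>l \<in> {e. split_epimorphism C e}. \<exists>r \<in> {m. monomorphism C m}.
        Dom C r = Cod C l \<and> f = r \<cdot> l"
      using fact by blast
  qed
qed

section \<open>Absolute pushouts of a morphism with itself\<close>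

lemma absolute_self_pushout_split_epi:
  assumes "has_absolute_pushout C f f"
  shows "split_epimorphism C f"
proof (cases "\<exists>c0 c1 :: 'm. c0 \<noteq> c1")
  \<comment> \<open>Subsets of hom-sets are tested by maps into two distinct values of type
    \<open>'m\<close>, so a one-element morphism type is treated separately.\<close>
  case True
  then obtain c0 c1 :: 'm where ne: "c0 \<noteq> c1" by blast
  obtain p q where ap: "absolute_pushout C f f p q"
    using assms by (auto simp: has_absolute_pushout_def)
  have po: "is_pushout C f f p q"
    using ap by (simp add: absolute_pushout_def)
  have mem: "f \<in> Mor C" "p \<in> hom C (Cod C f) (Cod C p)" "q \<in> hom C (Cod C f) (Cod C p)"
    using po by (auto simp: is_pushout_def hom_def)
  have obj: "Cod C f \<in> Obj C" "Cod C p \<in> Obj C"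
    using mem Cod_in by (auto simp: hom_def)
  \<comment> \<open>\<open>n\<close> is the codiagonal, induced by the pair of identities.\<close>
  obtain n where n: "n \<in> hom C (Cod C p) (Cod C f)" "n \<cdot> p = Ident C (Cod C f)"
      "n \<cdot> q = Ident C (Cod C f)"
    using is_pushout_mediating[OF po obj(1) Ident_in[OF obj(1)] Ident_in[OF obj(1)]] by auto
  \<comment> \<open>Let \<open>a\<close> be a leg through which the identity factors. It has left
    inverse \<open>n\<close> and right inverse \<open>y\<close>, so \<open>n\<close> is invertible
    and its only section is \<open>a\<close>. Both legs are sections of \<open>n\<close>.\<close>
  have leg: "p = q" if ab: "a \<in> hom C (Cod C f) (Cod C p)" "n \<cdot> a = Ident C (Cod C f)"
    and y: "y \<in> hom C (Cod C p) (Cod C f)" "Ident C (Cod C p) = a \<cdot> y" for a y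
  proof -
    have "n = y"
      using Comp_assoc[OF y(1) ab(1) n(1)] ab(2) y Ident_left[OF y(1)] Ident_right[OF n(1)] by simp
    then have "b = a" if "b \<in> hom C (Cod C f) (Cod C p)" "n \<cdot> b = Ident C (Cod C f)" for b
      using Comp_assoc[OF that(1) y(1) ab(1)] that y(2) Ident_left[OF that(1)] Ident_right[OF ab(1)]
      by simp
    then show ?thesis using mem n by metis
  qed
  have pq: "p = q"
    using absolute_pushout_surj[OF ap ne Ident_in[OF obj(2)]] leg mem n by blast
  show ?thesis
  proof (rule ccontr)
    assume "\<not> split_epimorphism C f"
    then have "f \<cdot> t \<noteq> Ident C (Cod C f)" if "t \<in> hom C (Cod C f) (Dom C f)" for t
      using that mem(1) by (auto simp: split_epimorphism_def)
    \<comment> \<open>Without a section of \<open>f\<close>, the sets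
      \<open>{Ident C (Cod C f)}\<close> and \<open>{}\<close> have the same, empty, preimage under
      composition with \<open>f\<close>. Hence both are restrictions of one \<open>U\<close>, which
      contains \<open>p\<close> but not \<open>q\<close>.\<close>
    then have "\<exists>U. (\<forall>y \<in> hom C (Cod C f) (Cod C f). p \<cdot> y \<in> U \<longleftrightarrow> y \<in> {Ident C (Cod C f)}) \<and>
        (\<forall>z \<in> hom C (Cod C f) (Cod C f). q \<cdot> z \<in> U \<longleftrightarrow> z \<in> {})"
      by (intro absolute_pushout_pred[OF ap ne]) auto
    then show False
      using pq Ident_in[OF obj(1)] by blast
  qed
next
  case False
  \<comment> \<open>As all morphisms coincide, \<open>f\<close> is the identity of its codomain and
    its own section.\<close>
  then have eq: "a = b" for a b :: 'm by blast
  have f: "f \<in> Mor C"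
    using assms by (auto simp: has_absolute_pushout_def absolute_pushout_def is_pushout_def)
  have "f \<in> hom C (Cod C f) (Cod C f)"
    using Ident_in[OF Cod_in[OF f]] eq[of "Ident C (Cod C f)" f] by simp
  then have "f \<in> hom C (Cod C f) (Dom C f)"
    by (auto simp: hom_def)
  then show ?thesis
    unfolding split_epimorphism_def using f eq by blast
qed

end

section \<open>The Eilenberg-Zilber structure of a Berger-Moerdijk EZ category\<close>

lemma (in berger_moerdijk_ez) is_eilenberg_zilber:
  "eilenberg_zilber A deg {e. split_epimorphism A e} {m. monomorphism A m}"
proof
  fix x y
  assume "isomorphic_objects A x y"
  then obtain f where "f \<in> hom A x y" "isomorphism A f"
    by (auto simp: isomorphic_objects_def)
  then show "deg x = deg y"
    using mono_preserves_deg[OF iso_mono] by (auto simp: hom_def)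
next
  show "orthogonal_factorization_system A {e. split_epimorphism A e} {m. monomorphism A m}"
    by (rule split_epi_mono_ofs) (rule split_epi_mono_factorization)
next
  fix e
  assume e: "e \<in> {e. split_epimorphism A e}" and ni: "\<not> isomorphism A e"
  obtain s where s: "s \<in> hom A (Cod A e) (Dom A e)" "Comp A e s = Ident A (Cod A e)" and eM: "e \<in> Mor A"
    using e unfolding split_epimorphism_def by blast
  \<comment> \<open>If \<open>s\<close> were invertible, \<open>e\<close> would be mono as well as
    split epi, hence invertible. So the section \<open>s\<close> is a noninvertible monomorphism and
    raises degree from \<open>Cod A e\<close> to \<open>Dom A e\<close>.\<close>
  have "\<not> isomorphism A s"
    using ni e mono_split_epi_iso retraction_of_iso_mono[OF eM s] by blast
  then show "deg (Cod A e) < deg (Dom A e)"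
    using mono_raises_deg[OF section_mono[OF eM s]] s(1) by (auto simp: hom_def)
qed (use mono_raises_deg split_epi_absolute_pushout in auto)

section \<open>Eilenberg-Zilber categories and the monomorphism condition on
  \<open>A_plus\<close>\<close>

context eilenberg_zilber
begin

lemma minus_iff: "f \<in> A_minus \<longleftrightarrow> f \<in> Mor A \<and> (\<forall>r \<in> A_plus. orthogonal A f r)"
  using ofs unfolding orthogonal_factorization_system_def by blast

lemma plus_iff: "f \<in> A_plus \<longleftrightarrow> f \<in> Mor A \<and> (\<forall>l \<in> A_minus. orthogonal A l f)"
  using ofs unfolding orthogonal_factorization_system_def by blast

lemma minus_plus_factorization:
  assumes "f \<in> Mor A"
  obtains l r where "l \<in> A_minus" "r \<in> A_plus" "Dom A r = Cod A l" "f = Comp A r l"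
  using ofs assms unfolding orthogonal_factorization_system_def by blast

text \<open>The pushout axiom is applied to the pair of \<open>f\<close> with itself.\<close>

lemma minus_split_epi: "f \<in> A_minus \<Longrightarrow> split_epimorphism A f"
  using minus_absolute_pushout absolute_self_pushout_split_epi by blast

lemma iso_deg: "isomorphism A f \<Longrightarrow> deg (Dom A f) = deg (Cod A f)"
  using deg_iso[of "Dom A f" "Cod A f"] Dom_in Cod_in Mor_hom
  unfolding isomorphic_objects_def isomorphism_def by blast

text \<open>Every monomorphism is right orthogonal to \<open>A_minus\<close>, which consists of
  split epimorphisms, so it lies in \<open>A_plus\<close>. Dually, under the hypothesis, every split
  epimorphism lies in \<open>A_minus\<close>. Each remaining axiom then follows from its Reedy or
  Eilenberg-Zilber counterpart.\<close>

lemma plus_mono_berger_moerdijk: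
  assumes plus: "\<And>f. f \<in> A_plus \<Longrightarrow> monomorphism A f"
  shows "berger_moerdijk_ez A deg"
proof
  have mono_plus: "m \<in> A_plus" if "monomorphism A m" for m
    using that minus_split_epi split_epi_orthogonal_mono plus_iff by (simp add: monomorphism_def)
  have split_epi_minus: "e \<in> A_minus" if "split_epimorphism A e" for e
    using that plus split_epi_orthogonal_mono minus_iff by (simp add: split_epimorphism_def)
  show "deg (Cod A m) = deg (Dom A m) \<longleftrightarrow> isomorphism A m" if "monomorphism A m" for m
    using plus_raises[OF mono_plus[OF that]] iso_deg[of m] by linarith
  show "deg (Dom A m) < deg (Cod A m) \<longleftrightarrow> \<not> isomorphism A m" if "monomorphism A m" for m
    using plus_raises[OF mono_plus[OF that]] iso_deg[of m] by linarith
  show "\<exists>e m. split_epimorphism A e \<and> monomorphism A m \<and> Dom A m = Cod A e \<and> f = Comp A m e"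
    if "f \<in> Mor A" for f
    using minus_plus_factorization[OF that] minus_split_epi plus by metis
  show "has_absolute_pushout A f g"
    if "split_epimorphism A f" "split_epimorphism A g" "Dom A f = Dom A g" for f g
    using that split_epi_minus minus_absolute_pushout by blast
qed

text \<open>
  Factor \<open>f\<close> as a split epimorphism \<open>e\<close> followed by a monomorphism. The \<open>A_minus\<close> part of \<open>e\<close> is
  invertible, being orthogonal to \<open>f\<close>, so \<open>e\<close> does not lower degree, and its section is a
  degree-preserving monomorphism.
\<close>

lemma berger_moerdijk_plus_mono:
  assumes bm: "berger_moerdijk_ez A deg" and f: "f \<in> A_plus"
  shows "monomorphism A f"
proof -
  interpret bm: berger_moerdijk_ez A deg by (rule bm)
  have fM: "f \<in> Mor A"
    using f plus_iff by blast
  obtain e m where em: "split_epimorphism A e" "monomorphism A m" "Dom A m = Cod A e" "f = Comp A m e"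
    using bm.split_epi_mono_factorization[OF fM] by blast
  obtain s where s: "s \<in> hom A (Cod A e) (Dom A e)" "Comp A e s = Ident A (Cod A e)" and eM: "e \<in> Mor A"
    using em(1) unfolding split_epimorphism_def by blast
  obtain l r where lr: "l \<in> A_minus" "r \<in> A_plus" "Dom A r = Cod A l" "e = Comp A r l"
    using minus_plus_factorization[OF eM] by blast
  have mor: "l \<in> Mor A" "r \<in> Mor A" "m \<in> Mor A"
    using lr(1,2) em(2) unfolding minus_iff[of l] plus_iff[of r] monomorphism_def by blast+
  note e = Comp_props[OF mor(1,2) lr(3), folded lr(4)]
  have mr: "Comp A m r \<in> Mor A" "Dom A (Comp A m r) = Cod A l"
    using Comp_props[OF mor(2,3)] em(3) e(3) lr(3) by auto
  \<comment> \<open>Regrouping exhibits \<open>l\<close> as the first factor of \<open>f\<close>, so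
    a lift of \<open>l\<close> against \<open>f\<close> yields a left inverse of
    \<open>l\<close>.\<close>
  have "f = Comp A (Comp A m r) l"
    using assoc[OF mor(1,2,3) lr(3)] em(3,4) e(3) lr(4) by simp
  then have "orthogonal A l (Comp A (Comp A m r) l)"
    using f lr(1) plus_iff by blast
  then obtain d where "d \<in> hom A (Cod A l) (Dom A l)" "Comp A d l = Ident A (Dom A l)"
    using orthogonal_fill_left[OF mor(1) mr] by blast
  then have "isomorphism A l"
    using mono_split_epi_iso minus_split_epi[OF lr(1)] left_inverse_mono[OF mor(1)] by blast
  then have "deg (Dom A e) = deg (Dom A r)"
    using iso_deg e lr(3) by simp
  \<comment> \<open>Morphisms of \<open>A_plus\<close> never lower degree.\<close>
  also have "\<dots> \<le> deg (Cod A e)"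
    using plus_raises[OF lr(2)] iso_deg[of r] e(3) by fastforce
  \<comment> \<open>A noninvertible \<open>s\<close> would force
    \<open>deg (Cod A e) < deg (Dom A e)\<close>.\<close>
  finally have "isomorphism A s"
    using bm.mono_raises_deg[OF section_mono[OF eM s]] s(1) by (auto simp: hom_def)
  then have "monomorphism A e"
    by (rule retraction_of_iso_mono[OF eM s])
  then show ?thesis
    using mono_comp[OF _ em(2,3)] em(4) by simp
qed

end

section \<open>Comparison of the two notions\<close>

theorem proposition5p2:
  fixes A :: "('o, 'm) cat" and deg :: "'o \<Rightarrow> nat"
  shows "(berger_moerdijk_ez A deg \<longrightarrow>
            (\<exists>A_minus A_plus. eilenberg_zilber A deg A_minus A_plus)) \<and>
         (\<forall>A_minus A_plus. eilenberg_zilber A deg A_minus A_plus \<longrightarrow>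
            (berger_moerdijk_ez A deg \<longleftrightarrow> (\<forall>f \<in> A_plus. monomorphism A f)))"
proof (intro conjI impI allI iffI ballI)
  assume "berger_moerdijk_ez A deg"
  \<comment> \<open>The witnesses are the classes of split epimorphisms and of
    monomorphisms.\<close>
  then show "\<exists>A_minus A_plus. eilenberg_zilber A deg A_minus A_plus"
    using berger_moerdijk_ez.is_eilenberg_zilber by blast
next
  fix A_minus A_plus
  assume ez: "eilenberg_zilber A deg A_minus A_plus"
  show "monomorphism A f" if "berger_moerdijk_ez A deg" "f \<in> A_plus" for f
    by (rule eilenberg_zilber.berger_moerdijk_plus_mono[OF ez that])
  show "berger_moerdijk_ez A deg" if "\<forall>f \<in> A_plus. monomorphism A f"
    using eilenberg_zilber.plus_mono_berger_moerdijk[OF ez] that by blast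
qed

end
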